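(* Let $G$ be a primitive permutation group acting on a finite set $\Omega$, and let $t:\Omega\to\Omega$ be a map of rank $2$. Then the semigroup $\langle G,t\rangle\setminus G$ is idempotent generated if and only if the following bipartite graph is connected: its vertices are the partitions in the $G$-orbit of the kernel partition $\ker(t)$ together with the $2$-sets in the $G$-orbit of the image $\Omega t$, and a set $S$ and a partition $P$ form an edge whenever $S$ is a transversal for $P$.
   Context: Maps act on the right and are composed from left to right. The rank of a map is the size of its image. $\ker(t)$ is the partition of $\Omega$ into the nonempty fibres of $t$. $\langle G,t\rangle$ is the semigroup generated by $G\cup\{t\}$. A semigroup is idempotent generated if every element is a product of idempotents of the semigroup. $G$ acts on subsets and partitions of $\Omega$ in the natural way. A set $S$ is a transversal (or section) for a partition $P$ if $S$ meets every part of $P$ in exactly one point. A permutation group is primitive if it is transitive and preserves no non-trivial partition of $\Omega$. *)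

theory Defs
  imports
    "HOL-Library.Disjoint_Sets"
    "Graph_Theory.Digraph_Component"
    "HOL-Algebra.Group_Action"
begin

text \<open>Maps on \<open>\<Omega>\<close> are extensional functions, as in \<^const>\<open>Bij\<close>. Maps act on the right: the
  product \<open>f \<otimes> g\<close> below is ``first \<open>f\<close>, then \<open>g\<close>'', the opposite of the product of
  \<^const>\<open>BijGroup\<close>. A set of bijections is a subgroup for one product iff it is for the other, so
  permutation groups are taken to be subgroups of \<^term>\<open>BijGroup \<Omega>\<close>.\<close>

definition transformation_monoid :: "'a set \<Rightarrow> ('a \<Rightarrow> 'a) monoid" where
  "transformation_monoid \<Omega> =
     \<lparr>carrier = \<Omega> \<rightarrow>\<^sub>E \<Omega>, mult = (\<lambda>f g. compose \<Omega> g f), one = (\<lambda>x\<in>\<Omega>. x)\<rparr>"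

inductive_set semigroup_gen :: "('a, 'b) monoid_scheme \<Rightarrow> 'a set \<Rightarrow> 'a set"
  for M (structure) and A where
  incl: "a \<in> A \<Longrightarrow> a \<in> semigroup_gen M A"
| mult: "a \<in> semigroup_gen M A \<Longrightarrow> b \<in> semigroup_gen M A \<Longrightarrow> a \<otimes> b \<in> semigroup_gen M A"

text \<open>\<open>S\<close> is meant to be a (possibly empty) subsemigroup of \<open>M\<close>; the elements of
  \<^term>\<open>semigroup_gen M A\<close> are the products of one or more elements of \<open>A\<close>.\<close>

definition idempotent_generated :: "('a, 'b) monoid_scheme \<Rightarrow> 'a set \<Rightarrow> bool" where
  "idempotent_generated M S \<longleftrightarrow> (\<forall>s\<in>S. s \<in> semigroup_gen M {e \<in> S. e \<otimes>\<^bsub>M\<^esub> e = e})"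

text \<open>The trivial partitions are the one with a single part and the one into singletons.\<close>

definition primitive_group :: "'a set \<Rightarrow> ('a \<Rightarrow> 'a) set \<Rightarrow> bool" where
  "primitive_group \<Omega> G \<longleftrightarrow>
     subgroup G (BijGroup \<Omega>) \<and>
     transitive_action (BijGroup \<Omega>\<lparr>carrier := G\<rparr>) \<Omega> (\<lambda>g. g) \<and>
     (\<forall>P. partition_on \<Omega> P \<and> (\<forall>g\<in>G. (\<lambda>A. g ` A) ` P = P) \<longrightarrow>
          P = {\<Omega>} \<or> P = (\<lambda>x. {x}) ` \<Omega>)"

definition kernel_partition :: "'a set \<Rightarrow> ('a \<Rightarrow> 'b) \<Rightarrow> 'a set set" where
  "kernel_partition \<Omega> t = (\<lambda>y. {x \<in> \<Omega>. t x = y}) ` (t ` \<Omega>)"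

definition transversal :: "'a set \<Rightarrow> 'a set set \<Rightarrow> bool" where
  "transversal S P \<longleftrightarrow> (\<forall>A\<in>P. \<exists>!x. x \<in> S \<inter> A)"

definition partition_orbit :: "'a set \<Rightarrow> ('a \<Rightarrow> 'a) set \<Rightarrow> 'a set set \<Rightarrow> 'a set set set" where
  "partition_orbit \<Omega> G P = orbit (BijGroup \<Omega>\<lparr>carrier := G\<rparr>) (\<lambda>g Q. (\<lambda>A. g ` A) ` Q) P"

definition set_orbit :: "'a set \<Rightarrow> ('a \<Rightarrow> 'a) set \<Rightarrow> 'a set \<Rightarrow> 'a set set" where
  "set_orbit \<Omega> G S = orbit (BijGroup \<Omega>\<lparr>carrier := G\<rparr>) (\<lambda>g A. g ` A) S"

text \<open>An undirected graph is a symmetric digraph: every edge is present as a pair of opposite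
  arcs. \<^term>\<open>Inl P\<close> is a partition vertex, \<^term>\<open>Inr S\<close> a set vertex.\<close>

definition kernel_image_graph ::
    "'a set \<Rightarrow> ('a \<Rightarrow> 'a) set \<Rightarrow> ('a \<Rightarrow> 'a) \<Rightarrow> ('a set set + 'a set) pair_pre_digraph" where
  "kernel_image_graph \<Omega> G t =
     (let \<P> = partition_orbit \<Omega> G (kernel_partition \<Omega> t);
          \<S> = set_orbit \<Omega> G (t ` \<Omega>)
      in \<lparr>pverts = \<P> <+> \<S>,
          parcs = {(Inl P, Inr S) | P S. P \<in> \<P> \<and> S \<in> \<S> \<and> transversal S P} \<union>
                  {(Inr S, Inl P) | P S. P \<in> \<P> \<and> S \<in> \<S> \<and> transversal S P}\<rparr>)"

lemma monoid_transformation_monoid: "monoid (transformation_monoid \<Omega>)"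
  by (rule monoidI)
    (auto simp: transformation_monoid_def compose_assoc[symmetric] PiE_def compose_def
      extensional_def restrict_def fun_eq_iff)

lemma transitive_action_iff:
  assumes "subgroup G (BijGroup \<Omega>)"
  shows "transitive_action (BijGroup \<Omega>\<lparr>carrier := G\<rparr>) \<Omega> (\<lambda>g. g) \<longleftrightarrow>
    (\<forall>x\<in>\<Omega>. \<forall>y\<in>\<Omega>. \<exists>g\<in>G. g x = y)"
proof -
  have "group_action (BijGroup \<Omega>\<lparr>carrier := G\<rparr>) \<Omega> (\<lambda>g. g)"
    unfolding group_action_def group_hom_def group_hom_axioms_def
    using assms group.subgroup_imp_group[OF group_BijGroup assms] group_BijGroup
      subgroup.subset[OF assms]
    by (auto simp: hom_def)
  then show ?thesis
    by (auto simp: transitive_action_def transitive_action_axioms_def)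
qed

lemma partition_on_kernel_partition: "partition_on \<Omega> (kernel_partition \<Omega> t)"
  by (auto simp: kernel_partition_def partition_on_def disjoint_def)

lemma pair_sym_digraph_kernel_image_graph: "pair_sym_digraph (kernel_image_graph \<Omega> G t)"
  by unfold_locales
    (auto simp: kernel_image_graph_def Let_def symmetric_def intro!: symI)

end

theory Submission
  imports Defs
begin

text \<open>Write \<open>N\<close> for the semigroup \<open>\<langle>G, t\<rangle> \<setminus> G\<close> and \<open>\<Gamma>\<close> for the bipartite graph. On two points
  \<open>t\<close> is a permutation, transitivity puts it into \<open>G\<close>, so \<open>N\<close> is empty and \<open>\<Gamma>\<close> is a single edge.
  On more than two points, \<open>N\<close> consists of the elements of rank at most \<open>2\<close>; those of rank \<open>2\<close> have
  their kernel in the orbit of \<open>ker(t)\<close> and their image in the orbit of \<open>\<Omega>t\<close>.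

  An idempotent of rank \<open>2\<close> has its image as a transversal of its kernel, and a product \<open>u v\<close> of rank
  \<open>2\<close> requires the image of \<open>u\<close> to be a transversal of the kernel of \<open>v\<close>. So a product of idempotents
  of rank \<open>2\<close> spells out a path of \<open>\<Gamma>\<close> from its kernel to its image
  (\<open>idempotent_product_path\<close>). As every partition \<open>P\<close> and every set \<open>S\<close> in \<open>\<Gamma>\<close> are the kernel and the
  image of some \<open>g t h\<close>, idempotent generation makes \<open>\<Gamma>\<close> connected.

  Conversely, constants are idempotents, and every edge \<open>(P, S)\<close> is realised by an idempotent of \<open>N\<close>
  with kernel \<open>P\<close> and image \<open>S\<close> (\<open>edge_idempotent\<close>). Multiplying along a path from \<open>P\<close> to \<open>S\<close> gives
  one of the two maps with kernel \<open>P\<close> and image \<open>S\<close>; the question is whether the other one, which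
  exchanges the two values, is also obtained. This is where primitivity enters
  (\<open>connected_transports_reversal\<close>). Follow ordered pairs instead of sets along the paths. If
  no closed path reverses a pair, then the pairs reachable from a fixed one orient every set in the
  orbit, giving a digraph \<open>D\<close> on \<open>\<Omega>\<close> that each element of \<open>G\<close> preserves or reverses, and all arcs of
  \<open>D\<close> between the two parts of a kernel go in the same direction. But a primitive group admits no
  such directed cut (\<open>primitive_group_no_directed_cut\<close>): up to sign, the outdegree minus the indegree
  is the same at all points, its level sets form an invariant partition, which on more than two
  points has a single part; so it is constant, hence zero, and then as many arcs enter a set as leave it.\<close>

section \<open>Permutation groups and kernel partitions\<close>

lemma subgroup_BijGroupD:
  assumes "subgroup G (BijGroup \<Omega>)"
  shows "g \<in> G \<Longrightarrow> bij_betw g \<Omega> \<Omega>"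
    and "g \<in> G \<Longrightarrow> g \<in> \<Omega> \<rightarrow>\<^sub>E \<Omega>"
    and "g \<in> G \<Longrightarrow> h \<in> G \<Longrightarrow> compose \<Omega> g h \<in> G"
    and "(\<lambda>x\<in>\<Omega>. x) \<in> G"
    and "g \<in> G \<Longrightarrow> \<exists>h\<in>G. \<forall>x\<in>\<Omega>. h (g x) = x \<and> g (h x) = x"
proof -
  have G: "G \<subseteq> Bij \<Omega>"
    using subgroup.subset[OF assms] by (simp add: BijGroup_def)
  show bij: "bij_betw g \<Omega> \<Omega>" if "g \<in> G" for g
    using G that by (auto simp: Bij_def)
  show "g \<in> \<Omega> \<rightarrow>\<^sub>E \<Omega>" if "g \<in> G"
    using G that by (auto simp: Bij_def PiE_def bij_betw_def)
  show "compose \<Omega> g h \<in> G" if "g \<in> G" "h \<in> G"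
    using subgroup.m_closed[OF assms that] subsetD[OF G that(1)] subsetD[OF G that(2)]
    by (simp add: BijGroup_def)
  show "(\<lambda>x\<in>\<Omega>. x) \<in> G"
    using subgroup.one_closed[OF assms] by (simp add: BijGroup_def)
  show "\<exists>h\<in>G. \<forall>x\<in>\<Omega>. h (g x) = x \<and> g (h x) = x" if g: "g \<in> G"
  proof
    show "(\<lambda>x\<in>\<Omega>. inv_into \<Omega> g x) \<in> G"
      using subgroup.m_inv_closed[OF assms g] inv_BijGroup[of g \<Omega>] G g by auto
    show "\<forall>x\<in>\<Omega>. (\<lambda>x\<in>\<Omega>. inv_into \<Omega> g x) (g x) = x \<and> g ((\<lambda>x\<in>\<Omega>. inv_into \<Omega> g x) x) = x"
      using bij[OF g]
      by (auto simp: bij_betw_def inv_into_f_f f_inv_into_f)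
  qed
qed

lemma primitive_group_transitive:
  assumes "primitive_group \<Omega> G" "x \<in> \<Omega>" "y \<in> \<Omega>"
  shows "\<exists>g\<in>G. g x = y"
proof -
  have "subgroup G (BijGroup \<Omega>)" "transitive_action (BijGroup \<Omega>\<lparr>carrier := G\<rparr>) \<Omega> (\<lambda>g. g)"
    using assms(1) by (simp_all add: primitive_group_def)
  then show ?thesis
    using assms(2,3) by (simp add: transitive_action_iff)
qed

lemma kernel_partition_trivial:
  assumes "kernel_partition \<Omega> f = {\<Omega>} \<or> kernel_partition \<Omega> f = (\<lambda>x. {x}) ` \<Omega>"
  shows "(\<forall>x\<in>\<Omega>. \<forall>y\<in>\<Omega>. f x = f y) \<or> inj_on f \<Omega>"
  using assms
proof
  assume one: "kernel_partition \<Omega> f = {\<Omega>}"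
  have "f x = f y" if "x \<in> \<Omega>" "y \<in> \<Omega>" for x y
  proof -
    have "{z \<in> \<Omega>. f z = f y} \<in> kernel_partition \<Omega> f"
      using that by (auto simp: kernel_partition_def)
    then show ?thesis
      using one that by auto
  qed
  then show ?thesis
    by blast
next
  assume singletons: "kernel_partition \<Omega> f = (\<lambda>x. {x}) ` \<Omega>"
  have "x = y" if "x \<in> \<Omega>" "y \<in> \<Omega>" "f x = f y" for x y
  proof -
    have "{z \<in> \<Omega>. f z = f y} \<in> kernel_partition \<Omega> f"
      using that by (auto simp: kernel_partition_def)
    then obtain w where "{z \<in> \<Omega>. f z = f y} = {w}"
      using singletons by auto
    moreover have "x \<in> {z \<in> \<Omega>. f z = f y}" "y \<in> {z \<in> \<Omega>. f z = f y}"
      using that by auto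
    ultimately have "x \<in> {w}" "y \<in> {w}"
      by simp_all
    then show ?thesis
      by simp
  qed
  then show ?thesis
    by (auto simp: inj_on_def)
qed

lemma image_kernel_partition:
  assumes "bij_betw g \<Omega> \<Omega>" and inverse: "\<And>x. x \<in> \<Omega> \<Longrightarrow> h x \<in> \<Omega> \<and> h (g x) = x \<and> g (h x) = x"
  shows "(\<lambda>A. g ` A) ` kernel_partition \<Omega> f = kernel_partition \<Omega> (f \<circ> h)"
proof -
  have g: "g x \<in> \<Omega>" if "x \<in> \<Omega>" for x
    using assms(1) that by (auto simp: bij_betw_def)
  have part: "g ` {x \<in> \<Omega>. f x = y} = {x \<in> \<Omega>. (f \<circ> h) x = y}" for y
    using inverse g by (force simp: image_iff)
  have range: "(f \<circ> h) ` \<Omega> = f ` \<Omega>"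
    using inverse g by (force simp: image_iff)
  show ?thesis
    unfolding kernel_partition_def range image_image[of "(`) g"] part ..
qed

text \<open>This identifies the kernel of every rank \<open>2\<close> element \<open>g t \<phi>\<close> of the semigroup with that of
  \<open>g t\<close>.\<close>

lemma kernel_partition_postcompose:
  assumes "inj_on \<phi> (f ` \<Omega>)" "\<And>x. x \<in> \<Omega> \<Longrightarrow> u x = \<phi> (f x)"
  shows "kernel_partition \<Omega> u = kernel_partition \<Omega> f"
proof -
  have part: "{z \<in> \<Omega>. u z = \<phi> y} = {z \<in> \<Omega>. f z = y}" if "y \<in> f ` \<Omega>" for y
    using assms that by (auto simp: inj_on_eq_iff)
  have range: "u ` \<Omega> = \<phi> ` f ` \<Omega>"
    using assms(2) by (auto simp: image_iff)
  show ?thesis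
    unfolding kernel_partition_def range image_image[of _ \<phi>] using part by (rule image_cong[OF refl])
qed

text \<open>For equal cardinalities, meeting no part twice already forces meeting every part.\<close>

lemma transversal_kernel_partition_iff_inj_on:
  assumes "finite \<Omega>" "S \<subseteq> \<Omega>" "card S = card (f ` \<Omega>)"
  shows "transversal S (kernel_partition \<Omega> f) \<longleftrightarrow> inj_on f S"
proof
  assume tr: "transversal S (kernel_partition \<Omega> f)"
  have ex1: "\<exists>!x. x \<in> S \<inter> {z \<in> \<Omega>. f z = f y}" if "y \<in> \<Omega>" for y
    using tr that by (auto simp: transversal_def kernel_partition_def)
  show "inj_on f S"
  proof (rule inj_onI)
    fix x y assume "x \<in> S" "y \<in> S" "f x = f y"
    then have "x \<in> S \<inter> {z \<in> \<Omega>. f z = f y}" "y \<in> S \<inter> {z \<in> \<Omega>. f z = f y}" "y \<in> \<Omega>"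
      using assms(2) by auto
    then show "x = y"
      using ex1[OF \<open>y \<in> \<Omega>\<close>] by metis
  qed
next
  assume inj: "inj_on f S"
  have image: "f ` S = f ` \<Omega>"
    using assms card_image[OF inj] by (intro card_subset_eq) auto
  show "transversal S (kernel_partition \<Omega> f)"
    unfolding transversal_def kernel_partition_def
  proof
    fix A assume "A \<in> (\<lambda>y. {x \<in> \<Omega>. f x = y}) ` f ` \<Omega>"
    then obtain y where y: "y \<in> f ` \<Omega>" "A = {x \<in> \<Omega>. f x = y}"
      by auto
    then obtain x where "x \<in> S" "f x = y"
      using image by (metis imageE)
    then show "\<exists>!x. x \<in> S \<inter> A"
      using y inj assms(2) by (auto simp: inj_on_def)
  qed
qed

section \<open>Directed cuts in primitive groups\<close>

text \<open>Arcs inside \<open>A\<close> contribute to both terms of the difference, so it is the net number of arcs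
  that leave \<open>A\<close>.\<close>

lemma sum_outdegree_minus_indegree:
  fixes D :: "('a \<times> 'a) set"
  assumes "finite D" "finite A"
  shows "(\<Sum>x\<in>A. int (card {y. (x, y) \<in> D}) - int (card {y. (y, x) \<in> D})) =
    int (card {e \<in> D. fst e \<in> A}) - int (card {e \<in> D. snd e \<in> A})"
proof -
  have out: "card {y. (x, y) \<in> D} = card {e \<in> D. fst e = x}" for x
    by (rule bij_betw_same_card[of "\<lambda>y. (x, y)"]) (auto simp: bij_betw_def inj_on_def)
  have "in": "card {y. (y, x) \<in> D} = card {e \<in> D. snd e = x}" for x
    by (rule bij_betw_same_card[of "\<lambda>y. (y, x)"]) (auto simp: bij_betw_def inj_on_def)
  have sum_fibres: "(\<Sum>x\<in>A. card {e \<in> D. f e = x}) = card {e \<in> D. f e \<in> A}" for f :: "'a \<times> 'a \<Rightarrow> 'a"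
  proof -
    have "{e \<in> D. f e \<in> A} = (\<Union>x\<in>A. {e \<in> D. f e = x})"
      by auto
    then show ?thesis
      using assms by (simp only:) (subst card_UN_disjoint; auto)
  qed
  show ?thesis
    using sum_fibres[of fst] sum_fibres[of snd]
    by (simp add: sum_subtractf out "in" flip: of_nat_sum)
qed

text \<open>The excess \<open>d x\<close> of the outdegree over the indegree changes at most its sign under \<open>G\<close>, so
  the level sets of \<open>d\<close> form a \<open>G\<close>-invariant partition. They are not singletons, because \<open>d\<close> takes at
  most two values on more than two points; hence \<open>d\<close> is constant, and it sums to \<open>0\<close> over \<open>\<Omega>\<close>. With
  \<open>d = 0\<close>, the number of arcs leaving a set equals the number of arcs entering it.\<close>

lemma primitive_group_no_directed_cut:
  fixes D :: "('a \<times> 'a) set"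
  assumes fin: "finite \<Omega>" and prim: "primitive_group \<Omega> G" and big: "card \<Omega> > 2"
    and D: "D \<subseteq> \<Omega> \<times> \<Omega>"
    and orient: "\<And>g. g \<in> G \<Longrightarrow>
      (\<forall>x\<in>\<Omega>. \<forall>y\<in>\<Omega>. (g x, g y) \<in> D \<longleftrightarrow> (x, y) \<in> D) \<or>
      (\<forall>x\<in>\<Omega>. \<forall>y\<in>\<Omega>. (g x, g y) \<in> D \<longleftrightarrow> (y, x) \<in> D)"
    and A: "A \<subseteq> \<Omega>" and leaves: "(p, q) \<in> D" "p \<in> A" "q \<notin> A"
  shows "\<exists>x y. (x, y) \<in> D \<and> x \<notin> A \<and> y \<in> A"
proof (rule ccontr)
  assume none_enters: "\<not> ?thesis"
  have sub: "subgroup G (BijGroup \<Omega>)"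
    using prim by (simp add: primitive_group_def)
  define d where "d x = int (card {y. (x, y) \<in> D}) - int (card {y. (y, x) \<in> D})" for x
  have d_signed: "(\<forall>x\<in>\<Omega>. d (g x) = d x) \<or> (\<forall>x\<in>\<Omega>. d (g x) = - d x)" if g: "g \<in> G" for g
  proof -
    have bij: "bij_betw g \<Omega> \<Omega>"
      using subgroup_BijGroupD(1)[OF sub g] .
    have card_preimage: "card {z. z \<in> \<Omega> \<and> Q z} = card {y. y \<in> \<Omega> \<and> Q (g y)}" for Q
    proof -
      have "bij_betw g {y. y \<in> \<Omega> \<and> Q (g y)} {z. z \<in> \<Omega> \<and> Q z}"
        using bij by (auto simp: bij_betw_def inj_on_def)
      then show ?thesis
        by (rule bij_betw_same_card[symmetric])
    qed
    \<comment> \<open>Neighbourhoods are written as subsets of \<open>\<Omega>\<close>, where \<open>g\<close> is a bijection.\<close>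
    have restrict: "{y. (x, y) \<in> D} = {y. y \<in> \<Omega> \<and> (x, y) \<in> D}"
        "{y. (y, x) \<in> D} = {y. y \<in> \<Omega> \<and> (y, x) \<in> D}" for x
      using D by auto
    show ?thesis
      using orient[OF g]
    proof
      assume "\<forall>x\<in>\<Omega>. \<forall>y\<in>\<Omega>. (g x, g y) \<in> D \<longleftrightarrow> (x, y) \<in> D"
      then have "d (g x) = d x" if "x \<in> \<Omega>" for x
        using that unfolding d_def restrict card_preimage[of "\<lambda>y. (g x, y) \<in> D"]
          card_preimage[of "\<lambda>y. (y, g x) \<in> D"]
        by (simp cong: conj_cong)
      then show ?thesis
        by blast
    next
      assume "\<forall>x\<in>\<Omega>. \<forall>y\<in>\<Omega>. (g x, g y) \<in> D \<longleftrightarrow> (y, x) \<in> D"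
      then have "d (g x) = - d x" if "x \<in> \<Omega>" for x
        using that unfolding d_def restrict card_preimage[of "\<lambda>y. (g x, y) \<in> D"]
          card_preimage[of "\<lambda>y. (y, g x) \<in> D"]
        by (simp cong: conj_cong)
      then show ?thesis
        by blast
    qed
  qed
  have invariant: "(\<lambda>B. g ` B) ` kernel_partition \<Omega> d = kernel_partition \<Omega> d" if g: "g \<in> G" for g
  proof -
    obtain h where h: "h \<in> G" "\<forall>x\<in>\<Omega>. h (g x) = x \<and> g (h x) = x"
      using subgroup_BijGroupD(5)[OF sub g] by blast
    have "(\<lambda>B. g ` B) ` kernel_partition \<Omega> d = kernel_partition \<Omega> (d \<circ> h)"
      using subgroup_BijGroupD(1,2)[OF sub] g h by (intro image_kernel_partition) auto
    also have "\<dots> = kernel_partition \<Omega> d"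
      using d_signed[OF h(1)]
    proof
      assume "\<forall>x\<in>\<Omega>. d (h x) = d x"
      then show ?thesis
        by (intro kernel_partition_postcompose[where \<phi> = id]) auto
    next
      assume "\<forall>x\<in>\<Omega>. d (h x) = - d x"
      then show ?thesis
        by (intro kernel_partition_postcompose[where \<phi> = uminus]) auto
    qed
    finally show ?thesis .
  qed
  have "\<forall>P. partition_on \<Omega> P \<and> (\<forall>g\<in>G. (\<lambda>A. g ` A) ` P = P) \<longrightarrow>
      P = {\<Omega>} \<or> P = (\<lambda>x. {x}) ` \<Omega>"
    using prim unfolding primitive_group_def by (elim conjE)
  then have "kernel_partition \<Omega> d = {\<Omega>} \<or> kernel_partition \<Omega> d = (\<lambda>x. {x}) ` \<Omega>"
    using invariant partition_on_kernel_partition[of \<Omega> d] by simp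
  then have dichotomy: "(\<forall>x\<in>\<Omega>. \<forall>y\<in>\<Omega>. d x = d y) \<or> inj_on d \<Omega>"
    by (rule kernel_partition_trivial)
  have p: "p \<in> \<Omega>"
    using leaves A by auto
  have "\<not> inj_on d \<Omega>"
  proof
    assume "inj_on d \<Omega>"
    moreover have "d ` \<Omega> \<subseteq> {d p, - d p}"
      using d_signed primitive_group_transitive[OF prim p] p by fastforce
    ultimately have "card \<Omega> \<le> card {d p, - d p}"
      by (metis card_image card_mono finite.emptyI finite_insert)
    also have "\<dots> \<le> 2"
      by (simp add: card_insert_if)
    finally show False
      using big by simp
  qed
  then have const: "d x = d p" if "x \<in> \<Omega>" for x
    using dichotomy that p by blast
  have finD: "finite D"
    using finite_subset[OF D] fin by simp
  have "sum d \<Omega> = 0"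
  proof -
    have "{e \<in> D. fst e \<in> \<Omega>} = {e \<in> D. snd e \<in> \<Omega>}"
      using D by auto
    then show ?thesis
      using sum_outdegree_minus_indegree[OF finD fin] by (simp add: d_def)
  qed
  moreover have "sum d \<Omega> = int (card \<Omega>) * d p"
    using const by simp
  ultimately have "d p = 0"
    using big by auto
  then have "sum d A = 0"
    using const A by (intro sum.neutral) auto
  moreover have "sum d A > 0"
  proof -
    have "{e \<in> D. snd e \<in> A} \<subset> {e \<in> D. fst e \<in> A}"
    proof
      show "{e \<in> D. snd e \<in> A} \<subseteq> {e \<in> D. fst e \<in> A}"
        using none_enters by force
      show "{e \<in> D. snd e \<in> A} \<noteq> {e \<in> D. fst e \<in> A}"
        using leaves by force
    qed
    then have "card {e \<in> D. snd e \<in> A} < card {e \<in> D. fst e \<in> A}"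
      using finD by (intro psubset_card_mono) auto
    then show ?thesis
      using sum_outdegree_minus_indegree[OF finD finite_subset[OF A fin]] by (simp add: d_def)
  qed
  ultimately show False
    by simp
qed


section \<open>Groups and maps of rank two\<close>

lemma compose_image_subset:
  assumes "A \<subseteq> \<Omega>"
  shows "compose \<Omega> g f ` A = g ` f ` A"
  unfolding image_image by (rule image_cong) (use assms in \<open>auto simp: compose_def\<close>)

lemma idempotent_if_rank_le_1:
  assumes "f \<in> \<Omega> \<rightarrow>\<^sub>E \<Omega>" "finite \<Omega>" "card (f ` \<Omega>) \<le> 1"
  shows "compose \<Omega> f f = f"
proof
  fix x
  show "compose \<Omega> f f x = f x"
  proof (cases "x \<in> \<Omega>")
    case True
    then have "f x \<in> \<Omega>"
      using assms(1) by auto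
    moreover have "\<forall>a\<in>f ` \<Omega>. \<forall>b\<in>f ` \<Omega>. a = b"
      using assms(3) unfolding One_nat_def card_le_Suc0_iff_eq[OF finite_imageI[OF assms(2)]] .
    ultimately have "f (f x) = f x"
      using True by blast
    then show ?thesis
      using True by (simp add: compose_def)
  next
    case False
    then show ?thesis
      using assms(1) by (auto simp: compose_def PiE_def extensional_def)
  qed
qed

locale primitive_group_rank_two_map =
  fixes \<Omega> :: "'a set" and G :: "('a \<Rightarrow> 'a) set" and t :: "'a \<Rightarrow> 'a"
  assumes fin: "finite \<Omega>"
    and prim: "primitive_group \<Omega> G"
    and t_map: "t \<in> \<Omega> \<rightarrow>\<^sub>E \<Omega>"
    and rank: "card (t ` \<Omega>) = 2"
begin

text \<open>\<open>N\<close> is the singular part of the semigroup and \<open>I\<close> the semigroup generated by its idempotents, so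
  that idempotent generation says \<open>N \<subseteq> I\<close>.\<close>

abbreviation "M \<equiv> transformation_monoid \<Omega>"
abbreviation "T \<equiv> semigroup_gen M (insert t G)"
abbreviation "N \<equiv> T - G"
abbreviation "I \<equiv> semigroup_gen M {e \<in> N. e \<otimes>\<^bsub>M\<^esub> e = e}"
abbreviation "\<P> \<equiv> partition_orbit \<Omega> G (kernel_partition \<Omega> t)"
abbreviation "\<S> \<equiv> set_orbit \<Omega> G (t ` \<Omega>)"
abbreviation "\<Gamma> \<equiv> kernel_image_graph \<Omega> G t"

lemma G_subgroup: "subgroup G (BijGroup \<Omega>)"
  using prim by (simp add: primitive_group_def)

lemmas G_bij = subgroup_BijGroupD(1)[OF G_subgroup]
  and G_map = subgroup_BijGroupD(2)[OF G_subgroup]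
  and G_compose = subgroup_BijGroupD(3)[OF G_subgroup]
  and G_id = subgroup_BijGroupD(4)[OF G_subgroup]
  and G_inverse = subgroup_BijGroupD(5)[OF G_subgroup]

lemma G_in: "g \<in> G \<Longrightarrow> x \<in> \<Omega> \<Longrightarrow> g x \<in> \<Omega>"
  using G_map by blast

lemma G_image: "g \<in> G \<Longrightarrow> g ` \<Omega> = \<Omega>"
  using G_bij by (auto simp: bij_betw_def)

lemma G_inj: "g \<in> G \<Longrightarrow> A \<subseteq> \<Omega> \<Longrightarrow> inj_on g A"
  using G_bij by (meson bij_betw_def inj_on_subset)

lemma t_in: "x \<in> \<Omega> \<Longrightarrow> t x \<in> \<Omega>"
  using t_map by blast

lemma t_image: "t ` \<Omega> \<subseteq> \<Omega>"
  using t_in by blast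

lemma mult_eq [simp]: "f \<otimes>\<^bsub>M\<^esub> g = compose \<Omega> g f"
  by (simp add: transformation_monoid_def)

lemma t_two_values:
  assumes "x \<in> \<Omega>" "y \<in> \<Omega>" "z \<in> \<Omega>" "t x \<noteq> t y"
  shows "t z = t x \<or> t z = t y"
proof (rule ccontr)
  assume "\<not> ?thesis"
  then have "card {t x, t y, t z} = 3"
    using assms by auto
  moreover have "card {t x, t y, t z} \<le> card (t ` \<Omega>)"
    using assms fin by (intro card_mono) auto
  ultimately show False
    using rank by simp
qed

lemma precompose_image: "g \<in> G \<Longrightarrow> (t \<circ> g) ` \<Omega> = t ` \<Omega>"
  by (simp only: image_comp[symmetric] G_image)

text \<open>The translate of \<open>ker(t)\<close> by \<open>g\<close> is the kernel of \<open>g\<inverse> t\<close>; as \<open>G\<close> is closed under inverses, the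
  orbit can be indexed by \<open>g\<close> instead of \<open>g\<inverse>\<close>.\<close>

lemma partition_orbit_iff: "P \<in> \<P> \<longleftrightarrow> (\<exists>g\<in>G. P = kernel_partition \<Omega> (t \<circ> g))"
proof -
  have move: "(\<lambda>A. g ` A) ` kernel_partition \<Omega> t = kernel_partition \<Omega> (t \<circ> h)"
    if "g \<in> G" "h \<in> G" "\<forall>x\<in>\<Omega>. h (g x) = x \<and> g (h x) = x" for g h
    using that by (intro image_kernel_partition) (auto simp: G_bij G_in)
  have orbit: "\<P> = {(\<lambda>A. g ` A) ` kernel_partition \<Omega> t | g. g \<in> G}"
    by (simp add: partition_orbit_def orbit_def)
  show ?thesis
  proof
    assume "P \<in> \<P>"
    then obtain g where "g \<in> G" "P = (\<lambda>A. g ` A) ` kernel_partition \<Omega> t"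
      unfolding orbit by auto
    then show "\<exists>g\<in>G. P = kernel_partition \<Omega> (t \<circ> g)"
      using G_inverse[of g] move by metis
  next
    assume "\<exists>g\<in>G. P = kernel_partition \<Omega> (t \<circ> g)"
    then obtain g where g: "g \<in> G" "P = kernel_partition \<Omega> (t \<circ> g)"
      by auto
    then obtain h where "h \<in> G" "\<forall>x\<in>\<Omega>. g (h x) = x \<and> h (g x) = x"
      using G_inverse[of g] by metis
    then have "P = (\<lambda>A. h ` A) ` kernel_partition \<Omega> t" "h \<in> G"
      using move g by simp_all
    then show "P \<in> \<P>"
      unfolding orbit by auto
  qed
qed

lemma set_orbit_iff: "S \<in> \<S> \<longleftrightarrow> (\<exists>h\<in>G. S = h ` t ` \<Omega>)"
  by (auto simp: set_orbit_def orbit_def)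

lemma set_orbitD:
  assumes "S \<in> \<S>"
  shows "S \<subseteq> \<Omega>" "card S = 2"
proof -
  obtain h where h: "h \<in> G" "S = h ` t ` \<Omega>"
    using assms set_orbit_iff by auto
  show "S \<subseteq> \<Omega>"
    using h t_in G_in by auto
  show "card S = 2"
    using card_image[OF G_inj[OF h(1) t_image]] h rank by simp
qed

lemma set_orbit_pairD:
  assumes "{x, y} \<in> \<S>"
  shows "x \<in> \<Omega>" "y \<in> \<Omega>" "x \<noteq> y"
  using set_orbitD[OF assms] by (auto simp: card_insert_if split: if_splits)

lemma set_orbit_image:
  assumes "S \<in> \<S>" "g \<in> G"
  shows "g ` S \<in> \<S>"
proof -
  obtain h where h: "h \<in> G" "S = h ` t ` \<Omega>"
    using assms set_orbit_iff by auto
  then have "g ` S = compose \<Omega> g h ` t ` \<Omega>"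
    by (simp only: compose_image_subset[OF t_image])
  then show ?thesis
    using G_compose[OF assms(2) h(1)] set_orbit_iff by blast
qed

lemma transversal_pair_iff:
  assumes "{x, y} \<in> \<S>" "g \<in> G"
  shows "transversal {x, y} (kernel_partition \<Omega> (t \<circ> g)) \<longleftrightarrow> t (g x) \<noteq> t (g y)"
proof -
  have "transversal {x, y} (kernel_partition \<Omega> (t \<circ> g)) \<longleftrightarrow> inj_on (t \<circ> g) {x, y}"
    using set_orbitD[OF assms(1)] fin rank precompose_image[OF assms(2)]
    by (intro transversal_kernel_partition_iff_inj_on) simp_all
  also have "\<dots> \<longleftrightarrow> t (g x) \<noteq> t (g y)"
    using set_orbit_pairD(3)[OF assms(1)] by auto
  finally show ?thesis .
qed

text \<open>A product with a factor \<open>t\<close> factors through its first \<open>t\<close>, as \<open>g t \<phi>\<close> with \<open>g\<close> the group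
  element before it, and its image is contained in that of \<open>t h\<close>, where \<open>h\<close> is the group element after
  the last \<open>t\<close>. For rank \<open>2\<close>, counting makes \<open>\<phi>\<close> injective on the image of \<open>t\<close> and turns the
  inclusion into an equality.\<close>

lemma semigroup_factorisation:
  assumes "s \<in> T"
  shows "s \<in> \<Omega> \<rightarrow>\<^sub>E \<Omega> \<and> (s \<in> G \<or>
    (\<exists>g\<in>G. \<exists>\<phi>. \<forall>x\<in>\<Omega>. s x = \<phi> (t (g x))) \<and> (\<exists>h\<in>G. s ` \<Omega> \<subseteq> h ` t ` \<Omega>))"
  using assms
proof induction
  case (incl s)
  then show ?case
  proof
    assume s: "s = t"
    have "\<forall>x\<in>\<Omega>. t x = id (t ((\<lambda>x\<in>\<Omega>. x) x))" "t ` \<Omega> \<subseteq> (\<lambda>x\<in>\<Omega>. x) ` t ` \<Omega>"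
      using t_in by (auto simp: image_iff)
    then show ?thesis
      using s G_id t_map by blast
  next
    assume "s \<in> G"
    then show ?thesis
      using G_map by simp
  qed
next
  case (mult u v)
  have map: "compose \<Omega> v u \<in> \<Omega> \<rightarrow>\<^sub>E \<Omega>"
    using mult.IH by (auto simp: compose_def)
  have image: "compose \<Omega> v u ` \<Omega> = v ` u ` \<Omega>"
    by (rule compose_image_subset) simp
  have u_in: "u x \<in> \<Omega>" if "x \<in> \<Omega>" for x
    using mult.IH that by auto
  have kernel: "\<exists>g\<in>G. \<exists>\<phi>. \<forall>x\<in>\<Omega>. compose \<Omega> v u x = \<phi> (t (g x))" if not_G: "\<not> (u \<in> G \<and> v \<in> G)"
  proof (cases "u \<in> G")
    case True
    then obtain g \<phi> where g: "g \<in> G" "\<forall>x\<in>\<Omega>. v x = \<phi> (t (g x))"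
      using mult.IH not_G True by auto
    then have "\<forall>x\<in>\<Omega>. compose \<Omega> v u x = \<phi> (t (compose \<Omega> g u x))"
      using u_in by (simp add: compose_def)
    then show ?thesis
      using G_compose[OF g(1) True] by blast
  next
    case False
    then obtain g \<phi> where g: "g \<in> G" "\<forall>x\<in>\<Omega>. u x = \<phi> (t (g x))"
      using mult.IH by auto
    then have "\<forall>x\<in>\<Omega>. compose \<Omega> v u x = (v \<circ> \<phi>) (t (g x))"
      by (simp add: compose_def)
    then show ?thesis
      using g(1) by blast
  qed
  have range: "\<exists>h\<in>G. compose \<Omega> v u ` \<Omega> \<subseteq> h ` t ` \<Omega>" if not_G: "\<not> (u \<in> G \<and> v \<in> G)"
  proof (cases "v \<in> G")
    case True
    then obtain h where h: "h \<in> G" "u ` \<Omega> \<subseteq> h ` t ` \<Omega>"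
      using mult.IH not_G True by auto
    have "compose \<Omega> v h ` t ` \<Omega> = v ` h ` t ` \<Omega>"
      using t_image by (rule compose_image_subset)
    then have "compose \<Omega> v u ` \<Omega> \<subseteq> compose \<Omega> v h ` t ` \<Omega>"
      unfolding image using h(2) by (simp only: image_mono)
    then show ?thesis
      using G_compose[OF True h(1)] by blast
  next
    case False
    then obtain h where h: "h \<in> G" "v ` \<Omega> \<subseteq> h ` t ` \<Omega>"
      using mult.IH by auto
    moreover have "v ` u ` \<Omega> \<subseteq> v ` \<Omega>"
      using u_in by auto
    ultimately show ?thesis
      unfolding image by blast
  qed
  show ?case
    using map kernel range G_compose by (cases "u \<in> G \<and> v \<in> G") auto
qed

lemma semigroup_map: "s \<in> T \<Longrightarrow> s \<in> \<Omega> \<rightarrow>\<^sub>E \<Omega>"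
  using semigroup_factorisation by blast

lemma singular_rank_le_2:
  assumes "s \<in> N"
  shows "card (s ` \<Omega>) \<le> 2"
proof -
  obtain h where h: "h \<in> G" "s ` \<Omega> \<subseteq> h ` t ` \<Omega>"
    using assms semigroup_factorisation by blast
  have "card (s ` \<Omega>) \<le> card (h ` t ` \<Omega>)"
    using h fin by (intro card_mono) auto
  also have "\<dots> = 2"
    using card_image[OF G_inj[OF h(1) t_image]] rank by simp
  finally show ?thesis .
qed

lemma singular_rank_2_kernel_image:
  assumes "s \<in> N" "card (s ` \<Omega>) = 2"
  shows "kernel_partition \<Omega> s \<in> \<P>" "s ` \<Omega> \<in> \<S>"
proof -
  obtain g \<phi> where g: "g \<in> G" "\<forall>x\<in>\<Omega>. s x = \<phi> (t (g x))"
    using assms semigroup_factorisation by blast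
  have "s ` \<Omega> = \<phi> ` (t \<circ> g) ` \<Omega>"
    using g(2) by (auto simp: image_iff)
  then have "inj_on \<phi> ((t \<circ> g) ` \<Omega>)"
    using assms(2) rank fin precompose_image[OF g(1)]
    by (intro eq_card_imp_inj_on) auto
  then have "kernel_partition \<Omega> s = kernel_partition \<Omega> (t \<circ> g)"
    using g(2) by (intro kernel_partition_postcompose) auto
  then show "kernel_partition \<Omega> s \<in> \<P>"
    using g(1) partition_orbit_iff by blast
  obtain h where h: "h \<in> G" "s ` \<Omega> \<subseteq> h ` t ` \<Omega>"
    using assms semigroup_factorisation by blast
  have "card (h ` t ` \<Omega>) = 2"
    using card_image[OF G_inj[OF h(1) t_image]] rank by simp
  then have "s ` \<Omega> = h ` t ` \<Omega>"
    using h assms(2) fin by (intro card_subset_eq) auto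
  then show "s ` \<Omega> \<in> \<S>"
    using h(1) set_orbit_iff by blast
qed

section \<open>The bipartite graph\<close>

sublocale graph: pair_sym_digraph \<Gamma>
  by (rule pair_sym_digraph_kernel_image_graph)

lemma vertices: "pverts \<Gamma> = \<P> <+> \<S>"
  by (simp add: kernel_image_graph_def Let_def)

lemma edge_iff:
  "(Inl P, Inr S) \<in> parcs \<Gamma> \<longleftrightarrow> P \<in> \<P> \<and> S \<in> \<S> \<and> transversal S P"
  "(Inr S, Inl P) \<in> parcs \<Gamma> \<longleftrightarrow> P \<in> \<P> \<and> S \<in> \<S> \<and> transversal S P"
  "(Inl P, Inl Q) \<notin> parcs \<Gamma>"
  "(Inr S, Inr S') \<notin> parcs \<Gamma>"
  by (auto simp: kernel_image_graph_def Let_def)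

lemma orbits_nonempty: "kernel_partition \<Omega> t \<in> \<P>" "t ` \<Omega> \<in> \<S>"
proof -
  have "kernel_partition \<Omega> t = kernel_partition \<Omega> (t \<circ> (\<lambda>x\<in>\<Omega>. x))"
    by (rule kernel_partition_postcompose[where \<phi> = id]) auto
  then show "kernel_partition \<Omega> t \<in> \<P>"
    using G_id partition_orbit_iff by blast
  have "t ` \<Omega> = (\<lambda>x\<in>\<Omega>. x) ` t ` \<Omega>"
    using t_image by (auto simp: image_iff)
  then show "t ` \<Omega> \<in> \<S>"
    using G_id set_orbit_iff by blast
qed

lemma reachable_sym:
  "u \<rightarrow>\<^sup>*\<^bsub>with_proj \<Gamma>\<^esub> v \<Longrightarrow> v \<rightarrow>\<^sup>*\<^bsub>with_proj \<Gamma>\<^esub> u"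
  using graph.pair_sym_arcs by (rule symmetric_reachable)

text \<open>Both orbits are nonempty, so paths between vertices of the same kind can be routed through a
  vertex of the other kind.\<close>

lemma connected_iff:
  "Digraph_Component.connected (with_proj \<Gamma>) \<longleftrightarrow>
    (\<forall>P\<in>\<P>. \<forall>S\<in>\<S>. Inl P \<rightarrow>\<^sup>*\<^bsub>with_proj \<Gamma>\<^esub> Inr S)"
proof -
  have "Digraph_Component.connected (with_proj \<Gamma>) \<longleftrightarrow>
      (\<forall>u\<in>pverts \<Gamma>. \<forall>v\<in>pverts \<Gamma>. u \<rightarrow>\<^sup>*\<^bsub>with_proj \<Gamma>\<^esub> v)"
    using orbits_nonempty graph.reachable_mk_symmetric_eq[OF graph.pair_sym_arcs]
    by (auto simp: connected_def strongly_connected_def vertices)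
  also have "\<dots> \<longleftrightarrow> (\<forall>P\<in>\<P>. \<forall>S\<in>\<S>. Inl P \<rightarrow>\<^sup>*\<^bsub>with_proj \<Gamma>\<^esub> Inr S)"
  proof
    assume paths: "\<forall>P\<in>\<P>. \<forall>S\<in>\<S>. Inl P \<rightarrow>\<^sup>*\<^bsub>with_proj \<Gamma>\<^esub> Inr S"
    have to: "u \<rightarrow>\<^sup>*\<^bsub>with_proj \<Gamma>\<^esub> Inr (t ` \<Omega>)" if "u \<in> pverts \<Gamma>" for u
    proof (cases u)
      case (Inl P)
      then show ?thesis
        using paths orbits_nonempty that by (auto simp: vertices)
    next
      case (Inr S)
      then have "Inr S \<rightarrow>\<^sup>*\<^bsub>with_proj \<Gamma>\<^esub> Inl (kernel_partition \<Omega> t)"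
        using paths orbits_nonempty that
        by (intro reachable_sym[of "Inl _"]) (auto simp: vertices)
      also have "\<dots> \<rightarrow>\<^sup>*\<^bsub>with_proj \<Gamma>\<^esub> Inr (t ` \<Omega>)"
        using paths orbits_nonempty by auto
      finally show ?thesis
        using Inr by simp
    qed
    show "\<forall>u\<in>pverts \<Gamma>. \<forall>v\<in>pverts \<Gamma>. u \<rightarrow>\<^sup>*\<^bsub>with_proj \<Gamma>\<^esub> v"
      by (intro ballI graph.reachable_trans[OF to reachable_sym[OF to]])
  qed (auto simp: vertices)
  finally show ?thesis .
qed

lemma connected_path:
  assumes "Digraph_Component.connected (with_proj \<Gamma>)" "P \<in> \<P>" "S \<in> \<S>"
  shows "Inl P \<rightarrow>\<^sup>*\<^bsub>with_proj \<Gamma>\<^esub> Inr S" "Inr S \<rightarrow>\<^sup>*\<^bsub>with_proj \<Gamma>\<^esub> Inl P"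
proof -
  show "Inl P \<rightarrow>\<^sup>*\<^bsub>with_proj \<Gamma>\<^esub> Inr S"
    using assms connected_iff by simp
  then show "Inr S \<rightarrow>\<^sup>*\<^bsub>with_proj \<Gamma>\<^esub> Inl P"
    by (rule reachable_sym)
qed

end

text \<open>On more than two points, rank distinguishes the elements of \<open>N\<close> from the permutations.\<close>

locale primitive_group_singular_rank_two_map = primitive_group_rank_two_map +
  assumes degree: "card \<Omega> > 2"
begin

lemma singular_iff: "s \<in> N \<longleftrightarrow> s \<in> T \<and> card (s ` \<Omega>) \<le> 2"
proof
  assume "s \<in> T \<and> card (s ` \<Omega>) \<le> 2"
  moreover from this have "s \<notin> G"
    using G_image[of s] degree by auto
  ultimately show "s \<in> N"
    by blast
qed (use singular_rank_le_2 in blast)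

lemma singular_mult:
  assumes "u \<in> N" "v \<in> N"
  shows "u \<otimes>\<^bsub>M\<^esub> v \<in> N"
proof -
  have "compose \<Omega> v u \<in> T"
    using assms semigroup_gen.mult[of u M "insert t G" v] by simp
  moreover have "compose \<Omega> v u ` \<Omega> \<subseteq> v ` \<Omega>"
    using assms semigroup_map by (fastforce simp: compose_def)
  then have "card (compose \<Omega> v u ` \<Omega>) \<le> 2"
    using card_mono[OF finite_imageI[OF fin], of "compose \<Omega> v u ` \<Omega>" v]
      singular_rank_le_2[OF assms(2)] by simp
  ultimately show ?thesis
    unfolding singular_iff mult_eq by blast
qed

lemma idempotent_products_singular:
  assumes "u \<in> I"
  shows "u \<in> N"
  using assms
proof induction
  case (mult u v)
  then show ?case
    by (intro singular_mult)
qed blast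

section \<open>Products of idempotents give paths\<close>

text \<open>An idempotent factor is an edge, as it is injective on its image. When two products of rank \<open>2\<close>
  are multiplied without loss of rank, the image of the first is a transversal of the kernel of the
  second, and this edge joins the two paths.\<close>

lemma idempotent_product_path:
  assumes "u \<in> I" "card (u ` \<Omega>) = 2"
  shows "Inl (kernel_partition \<Omega> u) \<rightarrow>\<^sup>*\<^bsub>with_proj \<Gamma>\<^esub> Inr (u ` \<Omega>)"
  using assms
proof induction
  case (incl e)
  then have e: "e \<in> N" "compose \<Omega> e e = e"
    by auto
  note orbits = singular_rank_2_kernel_image[OF e(1) incl(2)]
  have "e (e x) = e x" if "x \<in> \<Omega>" for x
    using fun_cong[OF e(2), of x] that by (simp add: compose_def)
  then have "inj_on e (e ` \<Omega>)"
    by (auto simp: inj_on_def)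
  then have "transversal (e ` \<Omega>) (kernel_partition \<Omega> e)"
    using set_orbitD(1)[OF orbits(2)] fin
    by (simp add: transversal_kernel_partition_iff_inj_on)
  then have "(Inl (kernel_partition \<Omega> e), Inr (e ` \<Omega>)) \<in> parcs \<Gamma>"
    using orbits by (simp add: edge_iff)
  then show ?case
    by (rule graph.reachable_adjI)
next
  case (mult u v)
  have N: "u \<in> N" "v \<in> N"
    using mult.hyps by (simp_all only: idempotent_products_singular)
  have u_in: "u ` \<Omega> \<subseteq> \<Omega>"
    using semigroup_map[of u] N(1) by auto
  have image: "compose \<Omega> v u ` \<Omega> = v ` u ` \<Omega>"
    by (rule compose_image_subset) simp
  have two: "card (v ` u ` \<Omega>) = 2"
    using mult.prems image by simp
  have "card (v ` u ` \<Omega>) \<le> card (u ` \<Omega>)"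
    using fin by (intro card_image_le) simp
  moreover have "card (v ` u ` \<Omega>) \<le> card (v ` \<Omega>)"
    using fin u_in by (intro card_mono image_mono) simp_all
  ultimately have ranks: "card (u ` \<Omega>) = 2" "card (v ` \<Omega>) = 2"
    using two singular_rank_le_2[OF N(1)] singular_rank_le_2[OF N(2)] by linarith+
  have same_image: "v ` u ` \<Omega> = v ` \<Omega>"
    using two ranks u_in fin by (intro card_subset_eq) auto
  have inj: "inj_on v (u ` \<Omega>)"
    using two ranks fin by (intro eq_card_imp_inj_on) auto
  then have "transversal (u ` \<Omega>) (kernel_partition \<Omega> v)"
    using u_in ranks fin by (simp add: transversal_kernel_partition_iff_inj_on)
  then have edge: "(Inr (u ` \<Omega>), Inl (kernel_partition \<Omega> v)) \<in> parcs \<Gamma>"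
    using singular_rank_2_kernel_image ranks N by (simp add: edge_iff)
  have kernel: "kernel_partition \<Omega> (compose \<Omega> v u) = kernel_partition \<Omega> u"
    using inj by (rule kernel_partition_postcompose) (simp add: compose_def)
  have "Inl (kernel_partition \<Omega> u) \<rightarrow>\<^sup>*\<^bsub>with_proj \<Gamma>\<^esub> Inr (u ` \<Omega>)"
    using mult.IH ranks by blast
  also have "\<dots> \<rightarrow>\<^sup>*\<^bsub>with_proj \<Gamma>\<^esub> Inl (kernel_partition \<Omega> v)"
    using edge by (rule graph.reachable_adjI)
  also have "\<dots> \<rightarrow>\<^sup>*\<^bsub>with_proj \<Gamma>\<^esub> Inr (v ` \<Omega>)"
    using mult.IH ranks by blast
  finally show ?case
    using kernel image same_image by simp
qed

lemma sandwich_in_semigroup: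
  assumes "g \<in> G" "h \<in> G"
  shows "compose \<Omega> h (compose \<Omega> t g) \<in> T"
proof -
  have "g \<in> T" "t \<in> T" "h \<in> T"
    using assms by (auto intro: semigroup_gen.incl)
  then have "(g \<otimes>\<^bsub>M\<^esub> t) \<otimes>\<^bsub>M\<^esub> h \<in> T"
    by (intro semigroup_gen.mult)
  then show ?thesis
    by simp
qed

lemma idempotent_generated_imp_connected:
  assumes "N \<subseteq> I"
  shows "Digraph_Component.connected (with_proj \<Gamma>)"
  unfolding connected_iff
proof (intro ballI)
  fix P S assume "P \<in> \<P>" "S \<in> \<S>"
  then obtain g h where g: "g \<in> G" "P = kernel_partition \<Omega> (t \<circ> g)" and h: "h \<in> G" "S = h ` t ` \<Omega>"
    using partition_orbit_iff set_orbit_iff by auto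
  define s where "s = compose \<Omega> h (compose \<Omega> t g)"
  have val: "s x = h ((t \<circ> g) x)" if "x \<in> \<Omega>" for x
    using that G_in[OF g(1)] by (simp add: s_def compose_def)
  have image: "s ` \<Omega> = S"
  proof -
    have "s ` \<Omega> = h ` (t \<circ> g) ` \<Omega>"
      using val by (auto simp: image_iff)
    then show ?thesis
      using precompose_image[OF g(1)] h by simp
  qed
  have rank_s: "card (s ` \<Omega>) = 2"
    using image set_orbitD[OF \<open>S \<in> \<S>\<close>] by simp
  have kernel: "kernel_partition \<Omega> s = P"
    unfolding g(2)
  proof (rule kernel_partition_postcompose)
    show "inj_on h ((t \<circ> g) ` \<Omega>)"
      using G_inj[OF h(1) t_image] precompose_image[OF g(1)] by simp
  qed (rule val)
  have "s \<in> N"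
    unfolding singular_iff using sandwich_in_semigroup[OF g(1) h(1)] rank_s by (simp add: s_def)
  then have "s \<in> I"
    using assms by blast
  then show "Inl P \<rightarrow>\<^sup>*\<^bsub>with_proj \<Gamma>\<^esub> Inr S"
    using idempotent_product_path[OF _ rank_s] kernel image by simp
qed

section \<open>Transporting ordered pairs\<close>

text \<open>An ordered pair from the set orbit is moved to another one through a common partition of which
  both are transversals, corresponding entries lying in the same part. These are the steps of the
  double cover of \<open>\<Gamma>\<close> in which every set and every partition comes with an ordering of its two
  elements. The partition is given as the kernel of \<open>t \<circ> g\<close>.\<close>

definition transport :: "('a \<times> 'a) rel" where
  "transport = {((x, y), (x', y')) | x y x' y'. {x, y} \<in> \<S> \<and> {x', y'} \<in> \<S> \<and>
     (\<exists>g\<in>G. t (g x) \<noteq> t (g y) \<and> t (g x') = t (g x) \<and> t (g y') = t (g y))}"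

lemma transport_iff:
  "((x, y), (x', y')) \<in> transport \<longleftrightarrow> {x, y} \<in> \<S> \<and> {x', y'} \<in> \<S> \<and>
     (\<exists>g\<in>G. t (g x) \<noteq> t (g y) \<and> t (g x') = t (g x) \<and> t (g y') = t (g y))"
  by (simp add: transport_def)

lemma transport_sym: "sym (transport\<^sup>*)"
proof (rule sym_rtrancl)
  show "sym transport"
    unfolding sym_def split_paired_All transport_iff by metis
qed

lemma transport_swap:
  assumes "((x, y), (x', y')) \<in> transport\<^sup>*"
  shows "((y, x), (y', x')) \<in> transport\<^sup>*"
  using assms
proof (induction rule: rtrancl_induct2)
  case (step u v u' v')
  then have "((v, u), (v', u')) \<in> transport"
    unfolding transport_iff insert_commute[of v u] insert_commute[of v' u'] by metis
  then show ?case
    using step.IH by simp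
qed simp

lemma transport_equivariant:
  assumes "((x, y), (x', y')) \<in> transport\<^sup>*" "k \<in> G"
  shows "((k x, k y), (k x', k y')) \<in> transport\<^sup>*"
  using assms(1)
proof (induction rule: rtrancl_induct2)
  case (step u v u' v')
  obtain l where l: "l \<in> G" "\<forall>x\<in>\<Omega>. l (k x) = x"
    using G_inverse[OF assms(2)] by blast
  obtain g where g: "g \<in> G" "t (g u) \<noteq> t (g v)" "t (g u') = t (g u)" "t (g v') = t (g v)"
    and pairs: "{u, v} \<in> \<S>" "{u', v'} \<in> \<S>"
    using step.hyps by (auto simp: transport_iff)
  have cancel: "compose \<Omega> g l (k z) = g z" if "z \<in> \<Omega>" for z
    using that l G_in[OF assms(2)] by (simp add: compose_def)
  have "{k u, k v} \<in> \<S>" "{k u', k v'} \<in> \<S>"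
    using set_orbit_image[OF _ assms(2)] pairs by fastforce+
  then have "((k u, k v), (k u', k v')) \<in> transport"
    using g cancel set_orbit_pairD[OF pairs(1)] set_orbit_pairD[OF pairs(2)]
      G_compose[OF g(1) l(1)]
    unfolding transport_iff by (auto intro!: bexI[of _ "compose \<Omega> g l"])
  then show ?case
    using step.IH by simp
qed simp

lemma transport_pair:
  assumes "((x, y), (x', y')) \<in> transport\<^sup>*" "{x, y} \<in> \<S>"
  shows "{x', y'} \<in> \<S>"
  using assms(1)
proof (induction rule: rtrancl_induct2)
  case refl
  show ?case
    by (rule assms(2))
next
  case (step u v u' v')
  then show ?case
    by (simp add: transport_iff)
qed

text \<open>A path in \<open>\<Gamma>\<close> lifts to the double cover, but the ordering in which it arrives cannot be
  prescribed.\<close>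

lemma path_transports:
  assumes "Inr {a, b} \<rightarrow>\<^sup>*\<^bsub>with_proj \<Gamma>\<^esub> v" "{a, b} \<in> \<S>"
  shows "case v of
      Inl P \<Rightarrow> \<exists>x y. ((a, b), (x, y)) \<in> transport\<^sup>* \<and> transversal {x, y} P
    | Inr S \<Rightarrow> \<exists>x y. ((a, b), (x, y)) \<in> transport\<^sup>* \<and> S = {x, y}"
  using assms(1)
proof (induction rule: graph.reachable_induct)
  case base
  then show ?case
    by auto
next
  case (step v w)
  show ?case
  proof (cases v)
    case (Inl P)
    then obtain S where w: "w = Inr S" and "P \<in> \<P>" and S: "S \<in> \<S>" and tr: "transversal S P"
      using step.hyps(2) edge_iff by (cases w) auto
    then obtain g where g: "g \<in> G" "P = kernel_partition \<Omega> (t \<circ> g)"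
      using partition_orbit_iff by blast
    obtain x y where xy: "((a, b), (x, y)) \<in> transport\<^sup>*" "transversal {x, y} P"
      using step.IH Inl by auto
    have pair: "{x, y} \<in> \<S>"
      using transport_pair[OF xy(1) assms(2)] .
    have cross: "t (g x) \<noteq> t (g y)"
      using transversal_pair_iff[OF pair g(1)] xy(2) g(2) by simp
    obtain c d where cd: "S = {c, d}"
      using set_orbitD(2)[OF S] by (auto simp: card_2_iff)
    have cross': "t (g c) \<noteq> t (g d)"
      using transversal_pair_iff[of c d g] S cd g tr by simp
    have in_\<Omega>: "g x \<in> \<Omega>" "g y \<in> \<Omega>" "g c \<in> \<Omega>" "g d \<in> \<Omega>"
      using set_orbit_pairD(1,2)[OF pair] set_orbitD(1)[OF S] cd G_in[OF g(1)] by simp_all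
    have "t (g c) = t (g x) \<and> t (g d) = t (g y) \<or> t (g d) = t (g x) \<and> t (g c) = t (g y)"
      using t_two_values[OF in_\<Omega>(1,2,3) cross] t_two_values[OF in_\<Omega>(1,2,4) cross] cross' by metis
    moreover have "S = {d, c}"
      using cd by auto
    ultimately obtain x' y' where xy': "S = {x', y'}" "t (g x') = t (g x)" "t (g y') = t (g y)"
      using cd by blast
    then have "((x, y), (x', y')) \<in> transport"
      using pair S g(1) cross unfolding transport_iff by blast
    then have "((a, b), (x', y')) \<in> transport\<^sup>*"
      using xy(1) by (rule rtrancl_into_rtrancl[rotated])
    then show ?thesis
      using w xy'(1) by auto
  next
    case (Inr S)
    then obtain P where "w = Inl P" "transversal S P"
      using step.hyps(2) edge_iff by (cases w) auto
    then show ?thesis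
      using step.IH Inr by auto
  qed
qed

lemma connected_transports_to_set:
  assumes "Digraph_Component.connected (with_proj \<Gamma>)" "{a, b} \<in> \<S>" "{c, d} \<in> \<S>"
  shows "((a, b), (c, d)) \<in> transport\<^sup>* \<or> ((a, b), (d, c)) \<in> transport\<^sup>*"
proof -
  have "Inr {a, b} \<rightarrow>\<^sup>*\<^bsub>with_proj \<Gamma>\<^esub> Inl (kernel_partition \<Omega> t)"
    using assms(1) orbits_nonempty(1) assms(2) by (rule connected_path)
  also have "\<dots> \<rightarrow>\<^sup>*\<^bsub>with_proj \<Gamma>\<^esub> Inr {c, d}"
    using assms(1) orbits_nonempty(1) assms(3) by (rule connected_path)
  finally obtain x y where "((a, b), (x, y)) \<in> transport\<^sup>*" "{c, d} = {x, y}"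
    using path_transports[of a b "Inr {c, d}"] assms(2) by auto
  then show ?thesis
    by (auto simp: doubleton_eq_iff)
qed

lemma connected_transports_to_partition:
  assumes "Digraph_Component.connected (with_proj \<Gamma>)" "{a, b} \<in> \<S>" "g \<in> G"
  obtains x y where "((a, b), (x, y)) \<in> transport\<^sup>*" "t (g x) \<noteq> t (g y)"
proof -
  have "kernel_partition \<Omega> (t \<circ> g) \<in> \<P>"
    using assms(3) partition_orbit_iff by blast
  then have "Inr {a, b} \<rightarrow>\<^sup>*\<^bsub>with_proj \<Gamma>\<^esub> Inl (kernel_partition \<Omega> (t \<circ> g))"
    using connected_path(2)[OF assms(1) _ assms(2)] by simp
  then obtain x y where "((a, b), (x, y)) \<in> transport\<^sup>*" "transversal {x, y} (kernel_partition \<Omega> (t \<circ> g))"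
    using path_transports[of a b "Inl (kernel_partition \<Omega> (t \<circ> g))"] assms(2) by auto
  then show ?thesis
    using that transversal_pair_iff[OF transport_pair assms(3)] assms(2) by simp
qed

text \<open>Otherwise the pairs reachable from \<open>(a, b)\<close> form an orientation \<open>D\<close> of the graph on \<open>\<Omega>\<close> whose
  edges are the sets of the orbit. Transports commute with \<open>G\<close> and with exchanging the entries of a
  pair, so every element of \<open>G\<close> preserves or reverses \<open>D\<close>. Two arcs crossing a kernel in opposite
  directions would be related by a transport after reversing one of them, so each kernel is a
  directed cut of \<open>D\<close>; some arc does cross it, because the partition is joined to a set in \<open>\<Gamma>\<close>.\<close>

lemma connected_transports_reversal:
  assumes conn: "Digraph_Component.connected (with_proj \<Gamma>)" and ab: "{a, b} \<in> \<S>"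
  shows "((a, b), (b, a)) \<in> transport\<^sup>*"
proof (rule ccontr)
  assume not_reversed: "\<not> ?thesis"
  define D where "D = transport\<^sup>* `` {(a, b)}"
  have D_iff: "(x, y) \<in> D \<longleftrightarrow> ((a, b), (x, y)) \<in> transport\<^sup>*" for x y
    by (simp add: D_def)
  have closed: "q \<in> D" if "p \<in> D" "(p, q) \<in> transport\<^sup>*" for p q
    using that by (auto simp: D_def)
  have pair: "{x, y} \<in> \<S>" if "(x, y) \<in> D" for x y
    using transport_pair[OF _ ab] that D_iff by simp
  have antisymmetric: "(y, x) \<notin> D" if "(x, y) \<in> D" for x y
  proof
    assume "(y, x) \<in> D"
    then have "((b, a), (x, y)) \<in> transport\<^sup>*"
      unfolding D_iff by (rule transport_swap)
    then have "((x, y), (b, a)) \<in> transport\<^sup>*"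
      by (rule symD[OF transport_sym])
    then have "(b, a) \<in> D"
      by (rule closed[OF that])
    then show False
      using not_reversed unfolding D_iff by blast
  qed
  have oriented: "(x, y) \<in> D \<or> (y, x) \<in> D" if "{x, y} \<in> \<S>" for x y
    using connected_transports_to_set[OF conn ab that] D_iff by simp
  have D_sub: "D \<subseteq> \<Omega> \<times> \<Omega>"
    using set_orbit_pairD(1,2)[OF pair] by auto
  have orient: "(\<forall>x\<in>\<Omega>. \<forall>y\<in>\<Omega>. (k x, k y) \<in> D \<longleftrightarrow> (x, y) \<in> D) \<or>
      (\<forall>x\<in>\<Omega>. \<forall>y\<in>\<Omega>. (k x, k y) \<in> D \<longleftrightarrow> (y, x) \<in> D)" if k: "k \<in> G" for k
  proof -
    have reflected: "{x, y} \<in> \<S>" if "(k x, k y) \<in> D" "x \<in> \<Omega>" "y \<in> \<Omega>" for x y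
    proof -
      obtain l where l: "l \<in> G" "\<forall>z\<in>\<Omega>. l (k z) = z"
        using G_inverse[OF k] by blast
      then show ?thesis
        using set_orbit_image[OF pair[OF that(1)] l(1)] l(2) that(2,3) by simp
    qed
    have image_ab: "{k a, k b} \<in> \<S>"
      using set_orbit_image[OF ab k] by simp
    consider "(k a, k b) \<in> D" | "(k b, k a) \<in> D"
      using oriented[OF image_ab] by blast
    then show ?thesis
    proof cases
      case 1
      have keep: "(k x, k y) \<in> D" if "(x, y) \<in> D" for x y
        by (rule closed[OF 1 transport_equivariant[OF that[unfolded D_iff] k]])
      have "(x, y) \<in> D" if "(k x, k y) \<in> D" "x \<in> \<Omega>" "y \<in> \<Omega>" for x y
        using oriented[OF reflected[OF that]] keep antisymmetric that(1) by blast
      then show ?thesis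
        using keep by blast
    next
      case 2
      have keep: "(k y, k x) \<in> D" if "(x, y) \<in> D" for x y
        by (rule closed[OF 2 transport_swap[OF transport_equivariant[OF that[unfolded D_iff] k]]])
      have "(y, x) \<in> D" if "(k x, k y) \<in> D" "x \<in> \<Omega>" "y \<in> \<Omega>" for x y
        using oriented[OF reflected[OF that]] keep antisymmetric that(1) by blast
      then show ?thesis
        using keep by blast
    qed
  qed
  obtain g where g: "g \<in> G"
    using G_id by blast
  obtain p q where pq: "(p, q) \<in> D" "t (g p) \<noteq> t (g q)"
    using connected_transports_to_partition[OF conn ab g] unfolding D_iff by metis
  define A where "A = {z \<in> \<Omega>. t (g z) = t (g p)}"
  have "\<exists>x y. (x, y) \<in> D \<and> x \<notin> A \<and> y \<in> A"
    using pq D_sub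
    by (intro primitive_group_no_directed_cut[OF fin prim degree D_sub orient, of A p q])
      (auto simp: A_def)
  then obtain x y where xy: "(x, y) \<in> D" "x \<notin> A" "y \<in> A"
    by blast
  have in_\<Omega>: "x \<in> \<Omega>" "y \<in> \<Omega>" "p \<in> \<Omega>" "q \<in> \<Omega>"
    using xy(1) pq(1) D_sub by auto
  have "t (g x) = t (g q)" "t (g y) = t (g p)"
    using t_two_values[of "g p" "g q" "g x"] pq(2) in_\<Omega> G_in[OF g] xy(2,3) by (auto simp: A_def)
  then have "((p, q), (y, x)) \<in> transport"
    using g pq(2) pair[OF pq(1)] pair[OF xy(1)]
    unfolding transport_iff by (auto simp: insert_commute)
  then have "(y, x) \<in> D"
    using closed[OF pq(1)] by blast
  then show False
    using antisymmetric[OF xy(1)] by blast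
qed

lemma connected_transports_all:
  assumes "Digraph_Component.connected (with_proj \<Gamma>)" "{a, b} \<in> \<S>" "{c, d} \<in> \<S>"
  shows "((a, b), (c, d)) \<in> transport\<^sup>*"
proof -
  have "((d, c), (c, d)) \<in> transport\<^sup>*"
    using connected_transports_reversal[OF assms(1), of d c] assms(3) by (simp add: insert_commute)
  then show ?thesis
    using connected_transports_to_set[OF assms] by (meson rtrancl_trans)
qed

section \<open>Realising transports by idempotents\<close>

text \<open>Some \<open>f = g t h\<close> has the kernel and the image of the edge. It either fixes or exchanges the two
  points of its image; correspondingly \<open>f\<close> or \<open>f\<^sup>2\<close> is the idempotent.\<close>

lemma edge_idempotent:
  assumes g: "g \<in> G" and pair: "{x, y} \<in> \<S>" and cross: "t (g x) \<noteq> t (g y)"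
  obtains e where "e \<in> N" "e \<otimes>\<^bsub>M\<^esub> e = e"
    "\<And>z. z \<in> \<Omega> \<Longrightarrow> e z = (if t (g z) = t (g x) then x else y)"
proof -
  note result = that
  obtain h where h: "h \<in> G" "{x, y} = h ` t ` \<Omega>"
    using pair set_orbit_iff by auto
  note xy = set_orbit_pairD[OF pair]
  define f where "f = compose \<Omega> h (compose \<Omega> t g)"
  have f_T: "f \<in> T"
    using sandwich_in_semigroup[OF g h(1)] by (simp add: f_def)
  have f_val: "f z = h (t (g z))" if "z \<in> \<Omega>" for z
    using that by (simp add: f_def compose_def)
  have f_in: "f z = x \<or> f z = y" if "z \<in> \<Omega>" for z
    using that h(2) f_val G_in[OF g] by auto
  have f_eq: "f z = f w \<longleftrightarrow> t (g z) = t (g w)" if "z \<in> \<Omega>" "w \<in> \<Omega>" for z w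
    using that inj_on_eq_iff[OF G_inj[OF h(1) t_image]] f_val G_in[OF g] by auto
  have f_values: "f z = (if t (g z) = t (g x) then f x else f y)" if "z \<in> \<Omega>" for z
    using t_two_values[of "g x" "g y" "g z"] cross that xy G_in[OF g] f_eq by auto
  have neq: "f x \<noteq> f y"
    using f_eq xy cross by simp
  have idempotent: thesis
    if e: "e \<in> T" "\<And>z. z \<in> \<Omega> \<Longrightarrow> e z = (if t (g z) = t (g x) then x else y)" for e
  proof (rule result[of e])
    have "e ` \<Omega> \<subseteq> {x, y}"
      using e(2) by auto
    then have "card (e ` \<Omega>) \<le> 2"
      using card_mono[of "{x, y}" "e ` \<Omega>"] xy(3) by simp
    then show "e \<in> N"
      using e(1) singular_iff by blast
    have "compose \<Omega> e e z = e z" for z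
      using e(2) xy cross semigroup_map[OF e(1)]
      by (cases "z \<in> \<Omega>") (auto simp: compose_def PiE_def extensional_def)
    then show "e \<otimes>\<^bsub>M\<^esub> e = e"
      by auto
  qed (rule e(2))
  consider "f x = x" "f y = y" | "f x = y" "f y = x"
    using f_in xy neq by metis
  then show thesis
  proof cases
    case 1
    then show thesis
      using idempotent[OF f_T] f_values by simp
  next
    case 2
    have "f \<otimes>\<^bsub>M\<^esub> f \<in> T"
      using f_T by (intro semigroup_gen.mult)
    moreover have "compose \<Omega> f f z = (if t (g z) = t (g x) then x else y)" if "z \<in> \<Omega>" for z
      using f_values[OF that] 2 that by (simp add: compose_def)
    ultimately show thesis
      using idempotent by simp
  qed
qed

text \<open>Each step of the transport is realised by right multiplication with the idempotent of the edge
  that enters the new pair.\<close>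

lemma transport_realised:
  assumes "((x, y), (x', y')) \<in> transport\<^sup>*" "e \<in> I"
  shows "\<exists>u\<in>I. \<forall>z\<in>\<Omega>. (e z = x \<longrightarrow> u z = x') \<and> (e z = y \<longrightarrow> u z = y')"
  using assms(1)
proof (induction rule: rtrancl_induct2)
  case refl
  then show ?case
    using assms(2) by blast
next
  case (step v w v' w')
  obtain u where u: "u \<in> I" "\<forall>z\<in>\<Omega>. (e z = x \<longrightarrow> u z = v) \<and> (e z = y \<longrightarrow> u z = w)"
    using step.IH by blast
  obtain g where g: "g \<in> G" "t (g v) \<noteq> t (g w)" "t (g v') = t (g v)" "t (g w') = t (g w)"
    and pairs: "{v, w} \<in> \<S>" "{v', w'} \<in> \<S>"
    using step.hyps by (auto simp: transport_iff)
  obtain f where f: "f \<in> N" "f \<otimes>\<^bsub>M\<^esub> f = f"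
    "\<And>z. z \<in> \<Omega> \<Longrightarrow> f z = (if t (g z) = t (g v') then v' else w')"
    using edge_idempotent[OF g(1) pairs(2)] g by metis
  have "f v = v'" "f w = w'"
    using f(3) g set_orbit_pairD[OF pairs(1)] by auto
  then have "\<forall>z\<in>\<Omega>. (e z = x \<longrightarrow> compose \<Omega> f u z = v') \<and> (e z = y \<longrightarrow> compose \<Omega> f u z = w')"
    using u(2) by (simp add: compose_def)
  moreover have "f \<in> I"
    using f(1,2) by (intro semigroup_gen.incl CollectI conjI)
  then have "u \<otimes>\<^bsub>M\<^esub> f \<in> I"
    using u(1) by (intro semigroup_gen.mult)
  ultimately show ?case
    unfolding mult_eq by blast
qed

text \<open>A map \<open>s\<close> of rank \<open>2\<close> is determined by its kernel and its values on a transversal \<open>{x, y}\<close> of it: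
  it equals \<open>e u\<close>, where \<open>e\<close> is the idempotent that collapses the kernel onto \<open>{x, y}\<close> and \<open>u\<close> transports
  \<open>(x, y)\<close> to \<open>(s x, s y)\<close>.\<close>

lemma connected_imp_idempotent_generated:
  assumes conn: "Digraph_Component.connected (with_proj \<Gamma>)" and s: "s \<in> N"
  shows "s \<in> I"
proof (cases "card (s ` \<Omega>) = 2")
  case False
  then have "card (s ` \<Omega>) \<le> 1"
    using singular_rank_le_2[OF s] by simp
  then have "s \<otimes>\<^bsub>M\<^esub> s = s"
    using idempotent_if_rank_le_1[OF semigroup_map[of s] fin] s by simp
  then show ?thesis
    using s by (intro semigroup_gen.incl CollectI conjI)
next
  case True
  obtain g \<phi> where g: "g \<in> G" "\<forall>x\<in>\<Omega>. s x = \<phi> (t (g x))"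
    using s semigroup_factorisation by blast
  obtain a b where ab: "{a, b} = t ` \<Omega>"
    using rank by (metis card_2_iff)
  obtain x y where xy: "((a, b), (x, y)) \<in> transport\<^sup>*" "t (g x) \<noteq> t (g y)"
    using connected_transports_to_partition[OF conn _ g(1)] ab orbits_nonempty(2) by metis
  have pair: "{x, y} \<in> \<S>"
    using transport_pair[OF xy(1)] ab orbits_nonempty(2) by simp
  note in_\<Omega> = set_orbit_pairD[OF pair]
  have s_values: "s z = (if t (g z) = t (g x) then s x else s y)" if "z \<in> \<Omega>" for z
    using t_two_values[of "g x" "g y" "g z"] xy(2) that in_\<Omega> G_in[OF g(1)] g(2) by metis
  have "s z \<in> {s x, s y}" if "z \<in> \<Omega>" for z
    using s_values[OF that] by (metis insertCI)
  then have "s ` \<Omega> = {s x, s y}"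
    using in_\<Omega>(1,2) by blast
  then have pair': "{s x, s y} \<in> \<S>"
    using singular_rank_2_kernel_image(2)[OF s True] by simp
  obtain e where e: "e \<in> N" "e \<otimes>\<^bsub>M\<^esub> e = e"
    "\<And>z. z \<in> \<Omega> \<Longrightarrow> e z = (if t (g z) = t (g x) then x else y)"
    using edge_idempotent[OF g(1) pair xy(2)] by blast
  have "e \<in> I"
    using e(1,2) by (intro semigroup_gen.incl CollectI conjI)
  then obtain u where u: "u \<in> I" "\<forall>z\<in>\<Omega>. (e z = x \<longrightarrow> u z = s x) \<and> (e z = y \<longrightarrow> u z = s y)"
    using transport_realised[OF connected_transports_all[OF conn pair pair']] by blast
  have "u = s"
  proof (rule extensionalityI)
    show "u \<in> extensional \<Omega>" "s \<in> extensional \<Omega>"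
      using semigroup_map[of u] semigroup_map[of s] idempotent_products_singular[OF u(1)] s
      by (simp_all add: PiE_iff)
    show "u z = s z" if "z \<in> \<Omega>" for z
      using that u(2) e(3) s_values by metis
  qed
  then show ?thesis
    using u(1) by simp
qed

end

section \<open>The case of two points\<close>

context primitive_group_rank_two_map
begin

lemma degree_ge_2: "card \<Omega> \<ge> 2"
  using card_image_le[OF fin, of t] rank by simp

text \<open>On two points a permutation is determined by one value, so transitivity gives an element of
  \<open>G\<close> equal to \<open>t\<close>.\<close>

lemma degree_2_semigroup:
  assumes "card \<Omega> = 2"
  shows "T \<subseteq> G"
proof -
  obtain a b where ab: "\<Omega> = {a, b}" "a \<noteq> b"
    using assms by (meson card_2_iff)
  have "inj_on t \<Omega>"
    using assms rank fin by (intro eq_card_imp_inj_on) auto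
  then have t_ab: "t a = a \<and> t b = b \<or> t a = b \<and> t b = a"
    using ab t_in by (auto simp: inj_on_def)
  obtain k where k: "k \<in> G" "k a = t a"
    using primitive_group_transitive[OF prim, of a "t a"] ab t_in by auto
  have "k b \<noteq> k a" "k b \<in> \<Omega>"
    using G_inj[OF k(1), of \<Omega>] G_in[OF k(1)] ab by (auto simp: inj_on_def)
  then have "k b = t b"
    using t_ab k(2) ab by auto
  then have "k = t"
    using k ab G_map[OF k(1)] t_map
    by (intro extensionalityI[of k \<Omega> t]) (auto simp: PiE_def)
  then have "t \<in> G"
    using k by simp
  have "s \<in> G" if "s \<in> T" for s
    using that by induction (use \<open>t \<in> G\<close> G_compose in auto)
  then show ?thesis
    by blast
qed

lemma degree_2_connected:
  assumes "card \<Omega> = 2"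
  shows "Digraph_Component.connected (with_proj \<Gamma>)"
  unfolding connected_iff
proof (intro ballI)
  fix P S assume P: "P \<in> \<P>" and S: "S \<in> \<S>"
  then obtain g where g: "g \<in> G" "P = kernel_partition \<Omega> (t \<circ> g)"
    using partition_orbit_iff by blast
  have "S = \<Omega>"
    using set_orbitD[OF S] assms fin by (intro card_subset_eq) auto
  moreover have "inj_on (t \<circ> g) \<Omega>"
    using precompose_image[OF g(1)] rank assms fin by (intro eq_card_imp_inj_on) auto
  ultimately have "transversal S P"
    using assms rank fin precompose_image[OF g(1)] g(2)
    by (simp add: transversal_kernel_partition_iff_inj_on)
  then show "Inl P \<rightarrow>\<^sup>*\<^bsub>with_proj \<Gamma>\<^esub> Inr S"
    using P S by (intro graph.reachable_adjI) (simp add: edge_iff)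
qed

end

section \<open>The equivalence\<close>

theorem theorem1p2:
  fixes \<Omega> :: "'a set" and G :: "('a \<Rightarrow> 'a) set" and t :: "'a \<Rightarrow> 'a"
  assumes "finite \<Omega>"
    and "primitive_group \<Omega> G"
    and "t \<in> \<Omega> \<rightarrow>\<^sub>E \<Omega>"
    and "card (t ` \<Omega>) = 2"
  shows "idempotent_generated (transformation_monoid \<Omega>)
           (semigroup_gen (transformation_monoid \<Omega>) (insert t G) - G) \<longleftrightarrow>
         Digraph_Component.connected (with_proj (kernel_image_graph \<Omega> G t))"
proof -
  interpret primitive_group_rank_two_map \<Omega> G t
    by unfold_locales (fact assms)+
  show ?thesis
  proof (cases "card \<Omega> = 2")
    case True
    then have "N = {}"
      using degree_2_semigroup by blast
    then have "idempotent_generated M N"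
      unfolding idempotent_generated_def by blast
    then show ?thesis
      using degree_2_connected[OF True] by simp
  next
    case False
    then interpret primitive_group_singular_rank_two_map \<Omega> G t
      using degree_ge_2 by unfold_locales simp
    show ?thesis
      using idempotent_generated_imp_connected connected_imp_idempotent_generated
      unfolding idempotent_generated_def by blast
  qed
qed

end
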